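(* Let $a,b\in\mathbb{C}$ with $|a|^2+|b|^2=1$, let $x\ge 1$ be an odd integer, and consider a chain of $x+2$ copies of $|\eta\rangle=a|00\rangle+b|11\rangle$. Let $|A_{x}\rangle$ be the random two-qubit output state after $x$ successive entanglement swaps (which use up the first $x+1$ copies), one further copy of $|\eta\rangle$ remaining. Suppose that $|A_x\rangle$ is distributed as follows: for each integer $n$ with $0\le n<\frac{x+1}{2}$, $$|A_x\rangle=|\eta_{x+1-2n}\rangle\ \text{ with probability }\ \binom{x+1}{n}\left(|a|^{2(x+1)-2n}|b|^{2n}+|a|^{2n}|b|^{2(x+1)-2n}\right),$$ and $|A_x\rangle=|\eta_0\rangle$ with probability $\binom{x+1}{\frac{x+1}{2}}|a|^{x+1}|b|^{x+1}$. Then the output $|A_{x+1}\rangle=S(|A_x\rangle\otimes|\eta\rangle)$ of the next swap is distributed as follows: for each integer $n$ with $0\le n\le \frac{x+1}{2}$, $$|A_{x+1}\rangle=|\eta_{x+2-2n}\rangle\ \text{ with probability }\ \binom{x+2}{n}\left(|a|^{2(x+2)-2n}|b|^{2n}+|a|^{2n}|b|^{2(x+2)-2n}\right).$$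
   Context: For $m\in\{0,1,2,\dots\}$ put $n_m=\sqrt{|a|^{2m}+|b|^{2m}}$ (with $0^0=1$) and $|\eta_m\rangle=\frac{a^m|00\rangle+b^m|11\rangle}{n_m}$, so $|\eta_1\rangle=|\eta\rangle$ and $|\eta_0\rangle=(|00\rangle+|11\rangle)/\sqrt2$. The entanglement swap map $S$ acts on $|\eta_m\rangle\otimes|\eta_p\rangle$ (qubits 1,2 carry $|\eta_m\rangle$, qubits 3,4 carry $|\eta_p\rangle$) as follows: apply CNOT with control qubit 2 and target qubit 3; apply a Hadamard gate to qubit 2; measure qubits 2 and 3 in the computational basis, with outcomes $s,t\in\{0,1\}$; apply $Z^s$ to qubit 1 and $X^t$ to qubit 4. The output is the resulting (random) state of qubits 1 and 4. States are identified when they agree up to a global phase and up to the simultaneous bit flip $X\otimes X$ (equivalently, in a swap the state of larger index is placed first). The outcomes $s,t$ are not recorded, so the output of $S$ is a random pure two-qubit state, described by listing the possible states with their probabilities; these labels are formal, i.e. the probability attached to label $|\eta_k\rangle$ is the total probability of the measurement outcomes giving index $k$ (outcome $t=0$ gives index $m+p$, outcome $t=1$ gives index $|m-p|$). In particular $S(|\eta_0\rangle\otimes|\eta\rangle)=|\eta\rangle$ with certainty. When $S$ is applied to a random state $|A\rangle\otimes|\eta\rangle$, the output is obtained by first sampling $|A\rangle$ and then performing the swap with independent measurement randomness. In the chain, $|A_0\rangle=|\eta\rangle$ and $|A_{k}\rangle=S(|A_{k-1}\rangle\otimes|\eta\rangle)$. *)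

theory Defs
  imports "HOL-Probability.Probability"
begin

text \<open>
  Bits are booleans (\<^term>\<open>False\<close> is 0, \<^term>\<open>True\<close> is 1). A qubit lives in
  \<^typ>\<open>complex ^ bool\<close>; the computational basis of a composite system is indexed by
  pairs. Four qubits 1, 2, 3, 4 are indexed by \<open>((q1, q2), (q3, q4))\<close>.
\<close>

type_synonym qubits2 = "complex ^ (bool \<times> bool)"
type_synonym qubits4 = "complex ^ ((bool \<times> bool) \<times> (bool \<times> bool))"

definition tensor_vec :: "complex ^ 'm \<Rightarrow> complex ^ 'n \<Rightarrow> complex ^ ('m \<times> 'n)" where
  "tensor_vec u v = (\<chi> i. u $ fst i * v $ snd i)"

definition tensor_mat ::
    "complex ^ 'm ^ 'm \<Rightarrow> complex ^ 'n ^ 'n \<Rightarrow> complex ^ ('m \<times> 'n) ^ ('m \<times> 'n)" where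
  "tensor_mat A B = (\<chi> i j. A $ fst i $ fst j * B $ snd i $ snd j)"

definition pauli_X :: "complex ^ bool ^ bool" where
  "pauli_X = (\<chi> i j. of_bool (i \<noteq> j))"

definition pauli_Z :: "complex ^ bool ^ bool" where
  "pauli_Z = (\<chi> i j. if i = j then (if i then - 1 else 1) else 0)"

definition hadamard :: "complex ^ bool ^ bool" where
  "hadamard = (\<chi> i j. (if i \<and> j then - 1 else 1) / complex_of_real (sqrt 2))"

text \<open>CNOT with control qubit 2 and target qubit 3, as a permutation matrix.\<close>

definition cnot23 ::
    "complex ^ ((bool \<times> bool) \<times> (bool \<times> bool)) ^ ((bool \<times> bool) \<times> (bool \<times> bool))" where
  "cnot23 = (\<chi> i j. of_bool (i = (case j of ((q1, q2), (q3, q4)) \<Rightarrow> ((q1, q2), (q3 \<noteq> q2, q4)))))"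

definition eta_norm :: "complex \<Rightarrow> complex \<Rightarrow> nat \<Rightarrow> real" where
  "eta_norm a b m = sqrt (cmod a ^ (2 * m) + cmod b ^ (2 * m))"

definition eta :: "complex \<Rightarrow> complex \<Rightarrow> nat \<Rightarrow> qubits2" where
  "eta a b m = (\<chi> i. (if i = (False, False) then a ^ m else if i = (True, True) then b ^ m else 0)
                       / complex_of_real (eta_norm a b m))"

text \<open>The four-qubit state immediately before the measurement.\<close>

definition swap_circuit :: "qubits2 \<Rightarrow> qubits2 \<Rightarrow> qubits4" where
  "swap_circuit u v =
     tensor_mat (tensor_mat (mat 1) hadamard) (tensor_mat (mat 1) (mat 1)) *v
       (cnot23 *v tensor_vec u v)"

text \<open>
  The unnormalised state of qubits 1 and 4 after outcome \<open>s\<close> on qubit 2 and \<open>t\<close> on qubit 3;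
  its squared norm is the Born probability of that outcome.
\<close>

definition measured :: "qubits2 \<Rightarrow> qubits2 \<Rightarrow> bool \<Rightarrow> bool \<Rightarrow> qubits2" where
  "measured u v s t = (\<chi> i. swap_circuit u v $ ((fst i, s), (t, snd i)))"

definition outcome_prob :: "qubits2 \<Rightarrow> qubits2 \<Rightarrow> bool \<Rightarrow> bool \<Rightarrow> real" where
  "outcome_prob u v s t = (norm (measured u v s t))\<^sup>2"

definition swap_output :: "qubits2 \<Rightarrow> qubits2 \<Rightarrow> bool \<Rightarrow> bool \<Rightarrow> qubits2" where
  "swap_output u v s t =
     tensor_mat (if s then pauli_Z else mat 1) (if t then pauli_X else mat 1) *v
       ((1 / norm (measured u v s t)) *\<^sub>R measured u v s t)"

definition outcome_pmf :: "qubits2 \<Rightarrow> qubits2 \<Rightarrow> (bool \<times> bool) pmf" where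
  "outcome_pmf u v = embed_pmf (\<lambda>(s, t). outcome_prob u v s t)"

text \<open>Equality up to a global phase and up to the simultaneous bit flip.\<close>

definition same_state :: "qubits2 \<Rightarrow> qubits2 \<Rightarrow> bool" where
  "same_state u v \<longleftrightarrow>
     (\<exists>c. cmod c = 1 \<and> (u = c *s v \<or> u = c *s (tensor_mat pauli_X pauli_X *v v)))"

definition swap_index :: "nat \<Rightarrow> nat \<Rightarrow> bool \<Rightarrow> nat" where
  "swap_index m p t = (if t then nat \<bar>int m - int p\<bar> else m + p)"

text \<open>
  Random states are distributions on formal labels: the label \<open>k\<close> stands for \<open>eta a b k\<close>, and
  labels are kept distinct even when the corresponding states coincide. The lemma
  \<open>swap_output_eta\<close> below shows that the labels assigned to the outcomes are correct, and
  \<open>pmf_outcome_eta\<close> that the outcome probabilities are normalised.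
\<close>

definition entanglement_swap :: "complex \<Rightarrow> complex \<Rightarrow> nat \<Rightarrow> nat \<Rightarrow> nat pmf" where
  "entanglement_swap a b m p = map_pmf (\<lambda>(s, t). swap_index m p t) (outcome_pmf (eta a b m) (eta a b p))"

primrec swap_chain :: "complex \<Rightarrow> complex \<Rightarrow> nat \<Rightarrow> nat pmf" where
  "swap_chain a b 0 = return_pmf 1"
| "swap_chain a b (Suc k) = bind_pmf (swap_chain a b k) (\<lambda>m. entanglement_swap a b m 1)"

lemma sum_bool2: "(\<Sum>i\<in>UNIV. f i) = f False + f True" for f :: "bool \<Rightarrow> 'a::comm_monoid_add"
  by (simp add: UNIV_bool add.commute)

lemma sum_prod2: "(\<Sum>i\<in>UNIV. f i) = (\<Sum>i\<in>UNIV. \<Sum>j\<in>UNIV. f (i, j))"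
  for f :: "'a::finite \<times> 'b::finite \<Rightarrow> 'c::comm_monoid_add"
  by (simp add: UNIV_Times_UNIV[symmetric] sum.cartesian_product del: UNIV_Times_UNIV)

definition amp :: "complex \<Rightarrow> complex \<Rightarrow> nat \<Rightarrow> bool \<Rightarrow> complex" where
  "amp a b m i = (if i then b ^ m else a ^ m) / complex_of_real (eta_norm a b m)"

lemma eta_nth: "eta a b m $ i = (if fst i = snd i then amp a b m (fst i) else 0)"
  by (cases i) (auto simp: eta_def amp_def)

lemma cnot23_nth: "(cnot23 *v \<psi>) $ ((q1, q2), (q3, q4)) = \<psi> $ ((q1, q2), (q3 \<noteq> q2, q4))"
  by (cases q1; cases q2; cases q3; cases q4)
     (simp_all add: cnot23_def matrix_vector_mult_def sum_prod2 sum_bool2)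

lemma hadamard2_nth:
  fixes w :: qubits4
  shows
  "(tensor_mat (tensor_mat (mat 1) hadamard) (tensor_mat (mat 1) (mat 1)) *v w)
     $ ((q1, q2), (q3, q4)) = (\<Sum>j\<in>UNIV. hadamard $ q2 $ j * w $ ((q1, j), (q3, q4)))"
  by (cases q1; cases q3; cases q4)
     (simp_all add: matrix_vector_mult_def tensor_mat_def sum_prod2 sum_bool2 mat_def)

lemma measured_eta:
  "measured (eta a b m) (eta a b p) s t $ (i, l) =
     (if l = (i \<noteq> t) then (if s \<and> i then - 1 else 1) * amp a b m i * amp a b p l
        / complex_of_real (sqrt 2) else 0)"
proof -
  let ?\<psi> = "tensor_vec (eta a b m) (eta a b p)"
  have "measured (eta a b m) (eta a b p) s t $ (i, l) =
      (\<Sum>j\<in>UNIV. hadamard $ s $ j * ((cnot23 *v ?\<psi>) $ ((i, j), (t, l))))"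
    by (simp add: measured_def swap_circuit_def hadamard2_nth)
  then show ?thesis
    by (cases i; cases l; cases t; cases s)
       (simp_all add: cnot23_nth sum_bool2 hadamard_def tensor_vec_def eta_nth)
qed

lemma eta_norm_pos:
  assumes "(cmod a)\<^sup>2 + (cmod b)\<^sup>2 = 1"
  shows "eta_norm a b m > 0"
proof -
  have "a \<noteq> 0 \<or> b \<noteq> 0" using assms by auto
  then have "cmod a ^ (2 * m) + cmod b ^ (2 * m) > 0"
    by (auto intro: add_pos_nonneg add_nonneg_pos)
  then show ?thesis by (simp add: eta_norm_def)
qed

lemma eta_norm_sq: "(eta_norm a b m)\<^sup>2 = cmod a ^ (2 * m) + cmod b ^ (2 * m)"
  by (simp add: eta_norm_def)

lemma amp_sq_sum:
  assumes "(cmod a)\<^sup>2 + (cmod b)\<^sup>2 = 1"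
  shows "(cmod (amp a b m False))\<^sup>2 + (cmod (amp a b m True))\<^sup>2 = 1"
proof -
  have "(eta_norm a b m)\<^sup>2 \<noteq> 0" using eta_norm_pos[OF assms, of m] by simp
  then show ?thesis
    by (simp add: amp_def norm_divide norm_power power_divide add_divide_distrib[symmetric]
        power_mult[symmetric] mult.commute eta_norm_sq)
qed

lemma norm_sq_vec: "(norm v)\<^sup>2 = (\<Sum>i\<in>UNIV. (cmod (v $ i))\<^sup>2)" for v :: "complex ^ 'n"
  by (simp add: norm_vec_def L2_set_def sum_nonneg)

lemma outcome_prob_eta:
  "outcome_prob (eta a b m) (eta a b p) s t =
     ((cmod (amp a b m False))\<^sup>2 * (cmod (amp a b p t))\<^sup>2
      + (cmod (amp a b m True))\<^sup>2 * (cmod (amp a b p (\<not> t)))\<^sup>2) / 2"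
  by (cases s; cases t)
     (simp_all add: outcome_prob_def norm_sq_vec sum_prod2 sum_bool2 measured_eta
        norm_mult norm_divide power_mult_distrib power_divide add_divide_distrib)

lemma outcome_prob_sum:
  assumes "(cmod a)\<^sup>2 + (cmod b)\<^sup>2 = 1"
  shows "(\<Sum>(s, t)\<in>UNIV. outcome_prob (eta a b m) (eta a b p) s t) = 1"
proof -
  have "(\<Sum>(s, t)\<in>UNIV. outcome_prob (eta a b m) (eta a b p) s t) =
      ((cmod (amp a b m False))\<^sup>2 + (cmod (amp a b m True))\<^sup>2)
      * ((cmod (amp a b p False))\<^sup>2 + (cmod (amp a b p True))\<^sup>2)"
    by (simp add: sum_prod2 sum_bool2 outcome_prob_eta field_simps)
  then show ?thesis using amp_sq_sum[OF assms] by simp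
qed

lemma pmf_outcome_eta:
  assumes "(cmod a)\<^sup>2 + (cmod b)\<^sup>2 = 1"
  shows "pmf (outcome_pmf (eta a b m) (eta a b p)) (s, t) =
    outcome_prob (eta a b m) (eta a b p) s t"
proof -
  let ?f = "\<lambda>(s, t). outcome_prob (eta a b m) (eta a b p) s t"
  have nn: "?f x \<ge> 0" for x by (auto simp: outcome_prob_def split: prod.split)
  have "(\<integral>\<^sup>+ x. ennreal (?f x) \<partial>count_space UNIV) = ennreal (\<Sum>x\<in>UNIV. ?f x)"
    using nn by (simp add: nn_integral_count_space_finite sum_ennreal)
  then have "(\<integral>\<^sup>+ x. ennreal (?f x) \<partial>count_space UNIV) = 1"
    using outcome_prob_sum[OF assms] by simp
  then show ?thesis
    using pmf_embed_pmf[of ?f "(s, t)"] nn by (simp add: outcome_pmf_def)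
qed

lemma corrected_nth:
  "(tensor_mat (if s then pauli_Z else mat 1) (if t then pauli_X else mat 1) *v w) $ (i, l) =
     (if s \<and> i then - 1 else 1) * w $ (i, l \<noteq> t)"
  by (cases s; cases t; cases i; cases l)
     (simp_all add: matrix_vector_mult_def tensor_mat_def sum_prod2 sum_bool2 pauli_X_def
        pauli_Z_def mat_def)

lemma flip_nth: "(tensor_mat pauli_X pauli_X *v w) $ (i, l) = w $ (\<not> i, \<not> l)"
  by (cases i; cases l)
     (simp_all add: matrix_vector_mult_def tensor_mat_def sum_prod2 sum_bool2 pauli_X_def)

lemma swap_output_nth:
  "swap_output (eta a b m) (eta a b p) s t $ (i, l) =
     (if i = l then amp a b m i * amp a b p (i \<noteq> t)
        / complex_of_real (sqrt 2 * norm (measured (eta a b m) (eta a b p) s t)) else 0)"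
  unfolding swap_output_def corrected_nth vector_scaleR_component measured_eta
  by (cases s; cases t; cases i; cases l) (simp_all add: scaleR_conv_of_real)

lemma norm_flip: "norm (tensor_mat pauli_X pauli_X *v w) = norm (w :: qubits2)"
proof -
  have "(norm (tensor_mat pauli_X pauli_X *v w))\<^sup>2 = (norm w)\<^sup>2"
    by (simp add: norm_sq_vec sum_prod2 sum_bool2 flip_nth)
  then show ?thesis by simp
qed

lemma norm_eta:
  assumes "(cmod a)\<^sup>2 + (cmod b)\<^sup>2 = 1"
  shows "norm (eta a b m) = 1"
proof -
  have "(norm (eta a b m))\<^sup>2 = 1"
    using amp_sq_sum[OF assms, of m] by (simp add: norm_sq_vec sum_prod2 sum_bool2 eta_nth)
  then show ?thesis
    using norm_ge_zero by (metis abs_of_nonneg abs_square_eq_1)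
qed

lemma norm_swap_output:
  assumes "outcome_prob (eta a b m) (eta a b p) s t \<noteq> 0"
  shows "norm (swap_output (eta a b m) (eta a b p) s t) = 1"
proof -
  define N where "N = norm (measured (eta a b m) (eta a b p) s t)"
  have N: "N\<^sup>2 = outcome_prob (eta a b m) (eta a b p) s t" and "N \<noteq> 0"
    using assms by (auto simp: N_def outcome_prob_def)
  have "(norm (swap_output (eta a b m) (eta a b p) s t))\<^sup>2 =
      outcome_prob (eta a b m) (eta a b p) s t / N\<^sup>2"
    unfolding outcome_prob_eta
    by (simp add: norm_sq_vec sum_prod2 sum_bool2 swap_output_nth N_def[symmetric] norm_mult
        norm_divide power_mult_distrib power_divide add_divide_distrib)
  then have "(norm (swap_output (eta a b m) (eta a b p) s t))\<^sup>2 = 1"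
    using N \<open>N \<noteq> 0\<close> by (metis div_self power_not_zero)
  then show ?thesis
    using norm_ge_zero by (metis abs_of_nonneg abs_square_eq_1)
qed

lemma norm_smult_vec: "norm (c *s v) = cmod c * norm v" for v :: "complex ^ 'n"
proof -
  have "(norm (c *s v))\<^sup>2 = (cmod c * norm v)\<^sup>2"
    by (simp add: norm_sq_vec norm_mult power_mult_distrib sum_distrib_left)
  then show ?thesis by (metis norm_ge_zero mult_nonneg_nonneg power2_eq_iff_nonneg)
qed

lemma swap_output_eta:
  assumes ab: "(cmod a)\<^sup>2 + (cmod b)\<^sup>2 = 1"
    and pos: "outcome_prob (eta a b m) (eta a b p) s t \<noteq> 0"
  shows "same_state (swap_output (eta a b m) (eta a b p) s t) (eta a b (swap_index m p t))"
proof -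
  let ?u = "swap_output (eta a b m) (eta a b p) s t"
  let ?v = "eta a b (swap_index m p t)"
  let ?F = "tensor_mat pauli_X pauli_X"
  define D where "D = complex_of_real (eta_norm a b m) * complex_of_real (eta_norm a b p)
     * complex_of_real (sqrt 2 * norm (measured (eta a b m) (eta a b p) s t))"
  have u: "?u $ (i, l) = (if i = l then (if i then b ^ m else a ^ m) *
      (if i \<noteq> t then b ^ p else a ^ p) / D else 0)" for i l
    by (simp add: swap_output_nth amp_def D_def)
  have nz: "complex_of_real (eta_norm a b k) \<noteq> 0" for k
    using eta_norm_pos[OF ab, of k] by simp
  have "\<exists>c. ?u = c *s ?v \<or> ?u = c *s (?F *v ?v)"
  proof (cases t)
    case False
    have "?u = (complex_of_real (eta_norm a b (m + p)) / D) *s ?v"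
      unfolding vec_eq_iff split_paired_All u using False nz
      by (simp add: eta_nth swap_index_def amp_def power_add)
    then show ?thesis by blast
  next
    case True
    show ?thesis
    proof (cases "p \<le> m")
      case le: True
      then obtain d where d: "m = p + d" by (metis le_Suc_ex)
      have "?u = ((a * b) ^ p * complex_of_real (eta_norm a b d) / D) *s ?v"
        unfolding vec_eq_iff split_paired_All u using True nz
        by (simp add: eta_nth swap_index_def amp_def power_add d power_mult_distrib)
      then show ?thesis by blast
    next
      case le: False
      then obtain d where d: "p = m + d" by (metis le_Suc_ex nat_le_linear)
      have "?u = ((a * b) ^ m * complex_of_real (eta_norm a b d) / D) *s (?F *v ?v)"
        unfolding vec_eq_iff split_paired_All u using True nz
        by (simp add: flip_nth eta_nth swap_index_def amp_def power_add d
            power_mult_distrib)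
      then show ?thesis by blast
    qed
  qed
  then obtain c where c: "?u = c *s ?v \<or> ?u = c *s (?F *v ?v)" by blast
  then have "cmod c = 1"
    using norm_swap_output[OF pos] norm_eta[OF ab] by (auto simp: norm_smult_vec norm_flip)
  with c show ?thesis by (auto simp: same_state_def)
qed

lemma swap_index_0_1: "swap_index 0 1 t = 1"
  by (simp add: swap_index_def)

lemma entanglement_swap_0_1: "entanglement_swap a b 0 1 = return_pmf 1"
  by (simp add: entanglement_swap_def case_prod_unfold swap_index_0_1 del: One_nat_def)

end

theory Submission
  imports Defs
begin

text \<open>
  With \<open>S\<^sub>m = |a|^(2m) + |b|^(2m)\<close>, the swap moves index \<open>m \<ge> 1\<close> to \<open>m + 1\<close> with probability
  \<open>S\<^sub>m\<^sub>+\<^sub>1 / S\<^sub>m\<close> and to \<open>m - 1\<close> with probability \<open>|ab|^2 S\<^sub>m\<^sub>-\<^sub>1 / S\<^sub>m\<close>. The assumed probability of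
  index \<open>x + 1 - 2n\<close> is \<open>(x + 1 choose n) |ab|^(2n) S\<^sub>x\<^sub>+\<^sub>1\<^sub>-\<^sub>2\<^sub>n\<close>, so the factors \<open>S\<^sub>m\<close> cancel and the
  two contributions to a new index combine by Pascal's rule. Index 0 lacks the factor
  \<open>S\<^sub>0 = 2\<close> and moves to 1 with certainty, which gives the same contribution because \<open>S\<^sub>1 = 1\<close>.
\<close>

lemma cmod_amp_sq: "(cmod (amp a b m i))\<^sup>2 = cmod (if i then b else a) ^ (2 * m) / (eta_norm a b m)\<^sup>2"
  by (simp add: amp_def norm_divide norm_power power_divide power_mult[symmetric] mult.commute)

text \<open>For \<open>m \<ge> 1\<close> the two values of \<open>t\<close> give different labels,
  so a label determines \<open>t\<close>. It collects two equally likely outcomes, one for each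
  \<open>s\<close>, which cancels the factor 1/2 in \<open>outcome_prob_eta\<close>. For
  \<open>m = 0\<close> both values of \<open>t\<close> give label 1.\<close>

lemma pmf_swap_index:
  assumes ab: "(cmod a)\<^sup>2 + (cmod b)\<^sup>2 = 1" and m: "m \<ge> 1"
  shows "pmf (entanglement_swap a b m 1) (swap_index m 1 t) =
    (cmod a ^ (2 * m) * (cmod (if t then b else a))\<^sup>2 + cmod b ^ (2 * m) * (cmod (if t then a else b))\<^sup>2)
      / (eta_norm a b m)\<^sup>2"
proof -
  have "(\<lambda>(s, t). swap_index m 1 t) -` {swap_index m 1 t} = {(False, t), (True, t)}"
    using m by (cases t) (auto simp: swap_index_def split: if_splits)
  then have "pmf (entanglement_swap a b m 1) (swap_index m 1 t) =
      2 * outcome_prob (eta a b m) (eta a b 1) False t"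
    by (simp add: entanglement_swap_def pmf_map measure_measure_pmf_finite
        pmf_outcome_eta[OF ab] outcome_prob_eta del: One_nat_def)
  moreover have "(eta_norm a b 1)\<^sup>2 = 1" using ab by (simp add: eta_norm_sq)
  ultimately show ?thesis
    by (simp add: outcome_prob_eta cmod_amp_sq add_divide_distrib del: One_nat_def)
qed

lemma pmf_entanglement_swap_up:
  assumes ab: "(cmod a)\<^sup>2 + (cmod b)\<^sup>2 = 1" and m: "m \<ge> 1"
  shows "pmf (entanglement_swap a b m 1) (m + 1) = (eta_norm a b (m + 1))\<^sup>2 / (eta_norm a b m)\<^sup>2"
  using pmf_swap_index[OF assms, of False]
  unfolding eta_norm_sq[of _ _ "m + 1"] by (simp add: swap_index_def power2_eq_square ac_simps)

lemma pmf_entanglement_swap_down: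
  assumes ab: "(cmod a)\<^sup>2 + (cmod b)\<^sup>2 = 1"
  shows "pmf (entanglement_swap a b (m + 1) 1) m =
    (cmod a * cmod b)\<^sup>2 * (eta_norm a b m)\<^sup>2 / (eta_norm a b (m + 1))\<^sup>2"
  using pmf_swap_index[OF ab, of "m + 1" True]
  unfolding eta_norm_sq[of _ _ m] by (simp add: swap_index_def power2_eq_square algebra_simps)

lemma set_pmf_entanglement_swap: "set_pmf (entanglement_swap a b m 1) \<subseteq> {m + 1, nat \<bar>int m - 1\<bar>}"
  by (auto simp: entanglement_swap_def swap_index_def split: if_splits)

text \<open>Each swap raises the label by at most one. This bound supplies the zero probability at
  the top end of the recursion, about which the hypotheses of the theorem say nothing.\<close>

lemma set_pmf_swap_chain: "set_pmf (swap_chain a b k) \<subseteq> {..k + 1}"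
proof (induction k)
  case (Suc k)
  show ?case
  proof
    fix j assume "j \<in> set_pmf (swap_chain a b (Suc k))"
    then obtain m where "m \<in> set_pmf (swap_chain a b k)" "j \<in> set_pmf (entanglement_swap a b m 1)"
      by auto
    then have "m \<le> k + 1" "j \<in> {m + 1, nat \<bar>int m - 1\<bar>}"
      using Suc set_pmf_entanglement_swap[of a b m] by blast+
    then show "j \<in> {..Suc k + 1}" by auto
  qed
qed simp

text \<open>Every swap changes the label by exactly one, so only \<open>j\<close> and
  \<open>j + 2\<close> lead to \<open>Suc j\<close>. This includes \<open>j = 0\<close>, since label
  0 always moves to 1.\<close>

lemma pmf_swap_chain_Suc:
  "pmf (swap_chain a b (Suc k)) (Suc j) =
     pmf (swap_chain a b k) j * pmf (entanglement_swap a b j 1) (Suc j) +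
     pmf (swap_chain a b k) (j + 2) * pmf (entanglement_swap a b (j + 2) 1) (Suc j)"
proof -
  have *: "m \<in> {j, j + 2}" if "pmf (entanglement_swap a b m 1) (Suc j) \<noteq> 0" for m
    using that set_pmf_entanglement_swap[of a b m] by (force simp: set_pmf_iff)
  show ?thesis
    unfolding swap_chain.simps pmf_bind
    by (subst integral_measure_pmf[of "{j, j + 2}"]) (use * in auto)
qed

text \<open>Pulling out the powers common to both terms leaves the squared norm that occurs in the
  transition probabilities, ready to cancel there.\<close>

lemma binomial_weight_eq:
  assumes "2 * n \<le> N"
  shows "cmod a ^ (2 * N - 2 * n) * cmod b ^ (2 * n) + cmod a ^ (2 * n) * cmod b ^ (2 * N - 2 * n) =
    (cmod a * cmod b) ^ (2 * n) * (eta_norm a b (N - 2 * n))\<^sup>2"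
proof -
  have "2 * N - 2 * n = 2 * n + 2 * (N - 2 * n)" using assms by simp
  then show ?thesis
    by (simp only: eta_norm_sq power_add power_mult_distrib) (simp add: algebra_simps)
qed

theorem theorem2:
  fixes a b :: complex and x :: nat
  assumes "(cmod a)\<^sup>2 + (cmod b)\<^sup>2 = 1"
    and "x \<ge> 1" and "odd x"
    and "\<And>n. n < (x + 1) div 2 \<Longrightarrow>
           pmf (swap_chain a b x) (x + 1 - 2 * n) =
             real ((x + 1) choose n) *
               (cmod a ^ (2 * (x + 1) - 2 * n) * cmod b ^ (2 * n)
                + cmod a ^ (2 * n) * cmod b ^ (2 * (x + 1) - 2 * n))"
    and "pmf (swap_chain a b x) 0 =
           real ((x + 1) choose ((x + 1) div 2)) * cmod a ^ (x + 1) * cmod b ^ (x + 1)"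
  shows "\<forall>n \<le> (x + 1) div 2.
           pmf (swap_chain a b (x + 1)) (x + 2 - 2 * n) =
             real ((x + 2) choose n) *
               (cmod a ^ (2 * (x + 2) - 2 * n) * cmod b ^ (2 * n)
                + cmod a ^ (2 * n) * cmod b ^ (2 * (x + 2) - 2 * n))"
proof (intro allI impI)
  fix n assume n: "n \<le> (x + 1) div 2"
  note ab = assms(1)
  define c where "c = cmod a * cmod b"
  define S where "S m = (eta_norm a b m)\<^sup>2" for m
  define p where "p = pmf (swap_chain a b x)"
  \<comment> \<open>The target label is \<open>Suc j\<close>; its predecessors \<open>j\<close> and
    \<open>j + 2\<close> carry the assumed weights with binomial index \<open>n\<close> and
    \<open>n - 1\<close>.\<close>
  define j where "j = x + 1 - 2 * n"
  have S_nz: "S m \<noteq> 0" for m using eta_norm_pos[OF ab, of m] by (simp add: S_def)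
  have j: "x + 1 = j + 2 * n" using n by (simp add: j_def)
  have p_pos: "p (x + 1 - 2 * i) = real ((x + 1) choose i) * (c ^ (2 * i) * S (x + 1 - 2 * i))"
    if "i < (x + 1) div 2" for i
    unfolding p_def assms(4)[OF that] c_def S_def using that by (subst binomial_weight_eq) auto
  have stay: "p j * pmf (entanglement_swap a b j 1) (Suc j) =
      real ((x + 1) choose n) * (c ^ (2 * n) * S (Suc j))"
  proof (cases "n = (x + 1) div 2")
    case True
    \<comment> \<open>Since \<open>x + 1\<close> is even, the last \<open>n\<close> lands exactly on
      label 0, whose weight is the separate hypothesis.\<close>
    with \<open>odd x\<close> have [simp]: "j = 0" and x: "x + 1 = 2 * n" by (auto simp: j_def)
    have "S 1 = 1" using ab by (simp add: S_def eta_norm_sq)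
    moreover have "p 0 = real ((x + 1) choose n) * c ^ (2 * n)"
      using assms(5) by (simp add: p_def c_def x power_mult_distrib del: One_nat_def)
    moreover have "pmf (entanglement_swap a b 0 1) 1 = 1" by (subst entanglement_swap_0_1) simp
    ultimately show ?thesis by simp
  next
    case False
    then have "j \<ge> 1" using n by (auto simp: j_def)
    then show ?thesis
      using p_pos[of n, folded j_def] n False S_nz[of j] pmf_entanglement_swap_up[OF ab, of j]
      by (simp add: S_def)
  qed
  \<comment> \<open>The conditional sets the binomial coefficient at index -1 to 0; truncated
    subtraction alone would give 1 at \<open>n = 0\<close>.\<close>
  have up: "p (j + 2) * pmf (entanglement_swap a b (j + 2) 1) (Suc j) =
      real (if n = 0 then 0 else (x + 1) choose (n - 1)) * (c ^ (2 * n) * S (Suc j))"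
  proof (cases n)
    case 0
    \<comment> \<open>Here \<open>j + 2 = x + 3\<close>, beyond the largest label
      \<open>x + 1\<close> possible after \<open>x\<close> swaps.\<close>
    then have "p (j + 2) = 0"
      using set_pmf_swap_chain[of a b x] by (auto simp: p_def j_def pmf_eq_0_set_pmf)
    then show ?thesis using 0 by simp
  next
    case (Suc i)
    then have "x + 1 - 2 * i = j + 2" "i < (x + 1) div 2" using j n by auto
    then have "p (j + 2) = real ((x + 1) choose i) * (c ^ (2 * i) * S (j + 2))"
      using p_pos[of i] by simp
    then show ?thesis
      using Suc S_nz[of "j + 2"] pmf_entanglement_swap_down[OF ab, of "Suc j"]
      by (simp add: S_def c_def power2_eq_square)
  qed
  \<comment> \<open>Pascal's rule, with the zero convention covering \<open>n = 0\<close>.\<close>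
  have "real ((x + 1) choose n) + real (if n = 0 then 0 else (x + 1) choose (n - 1)) =
      real ((x + 2) choose n)"
    by (cases n) simp_all
  then have "pmf (swap_chain a b (Suc x)) (Suc j) = real ((x + 2) choose n) * (c ^ (2 * n) * S (Suc j))"
    unfolding pmf_swap_chain_Suc using stay up unfolding p_def by (metis distrib_right)
  moreover have "x + 2 - 2 * n = Suc j" "2 * n \<le> x + 2" using j by auto
  ultimately show "pmf (swap_chain a b (x + 1)) (x + 2 - 2 * n) =
             real ((x + 2) choose n) *
               (cmod a ^ (2 * (x + 2) - 2 * n) * cmod b ^ (2 * n)
                + cmod a ^ (2 * n) * cmod b ^ (2 * (x + 2) - 2 * n))"
    by (subst binomial_weight_eq) (simp_all add: c_def S_def)
qed

end
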